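(* Consider a serial-chain segment, belonging to one of the two legs, that contains $n \geq 2$ consecutive revolute joints with joint offsets $\delta q_1,\dots,\delta q_n$. Fix a time sample and a base value of the full offset vector, and suppose that at the resulting configuration the axes of these $n$ joints are parallel when expressed in the same residual frame, with common unit direction $a \in \mathbb{R}^3$ (that is, each of the $n$ oriented unit axes, expressed in the residual frame, equals $a$). Let $J_\omega = [J_{\omega,1},\dots,J_{\omega,n}] \in \mathbb{R}^{3\times n}$ be the angular (rotational) Jacobian of the rotational component of the inter-foot residual with respect to the offsets of these $n$ joints, expressed in the residual frame. Then: (i) the columns $J_{\omega,1},\dots,J_{\omega,n}$ are collinear; (ii) to first order, the orientation residual observes only one linear combination of the segment's offsets, proportional to their sum: there is a sign $\sigma\in\{+1,-1\}$, common to all $n$ joints and fixed by the sign convention, such that for every perturbation $(\delta q_1,\dots,\delta q_n)\in\mathbb{R}^n$ of the segment's offsets the first-order orientation perturbation is $\delta\phi = J_\omega (\delta q_1,\dots,\delta q_n)^\top = \sigma\, a \sum_{i=1}^n \delta q_i$; (iii) the nullspace of $J_\omega$ in the space $\mathbb{R}^n$ of individual offsets of the segment is $(n-1)$-dimensional.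
   Context: Setting. A humanoid robot has two legs, each a serial chain of revolute joints (6 per leg) connecting the base (pelvis) frame $B$ to the foot frames $F_L$ (left) and $F_R$ (right). At time sample $k$ the encoder readings are $q_k^{\mathrm{enc}}\in\mathbb{R}^{12}$, and the corrected joint angles are $q_k = q_k^{\mathrm{enc}} + \delta q$, where $\delta q\in\mathbb{R}^{12}$ is a constant offset vector. Forward kinematics gives $T_{BF_L}(q_k), T_{BF_R}(q_k)\in \mathrm{SE}(3)$, where $T_{AB}$ maps coordinates in frame $B$ to coordinates in frame $A$. Each leg's forward-kinematics map is a product of fixed rigid transforms and, for each joint of that leg, a rotation about that joint's fixed oriented unit axis by its joint angle. Inter-foot transform and residual. The inter-foot transform is $$C_k(\delta q) = T_{BF_L}(q_k)^{-1}\, T_{BF_R}(q_k) \in \mathrm{SE}(3).$$ For a reference transform $C^*\in \mathrm{SE}(3)$ (the mean inter-foot transform of the contact segment, held fixed here), the inter-foot residual is $r_k(\delta q)=\mathrm{Log}\big((C^* )^{-1} C_k(\delta q)\big)\in\mathbb{R}^6$, whose last three components are its rotational (orientation) component. Angular Jacobian. Let $R(\delta q)\in \mathrm{SO}(3)$ denote the rotation part of $(C^* )^{-1}C_k(\delta q)$. The angular Jacobian of the rotational residual describes the first-order change of this rotation: its column for joint offset $i$, in the right-foot frame, is the vector $w_i\in\mathbb{R}^3$ whose associated skew-symmetric matrix is $R^\top\, \partial R/\partial (\delta q_i)$. All columns and all joint axes are expressed in one and the same residual frame: if $Q\in \mathrm{SO}(3)$ is the rotation from right-foot-frame coordinates to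 residual-frame coordinates at the configuration considered, then $J_{\omega,i}=Q w_i$ (the choice $Q=I$ gives the right-foot frame itself). The first-order orientation perturbation caused by a perturbation of the offsets is $\delta\phi = J_\omega\,\delta q$, where only the segment's offsets are perturbed and $\delta q$ denotes their perturbation vector. The common sign depends on the sign convention and on which of the two legs the segment belongs to. *)

theory Defs
  imports "HOL-Analysis.Analysis"
begin

text \<open>A rigid transform \<open>x \<mapsto> R x + p\<close> is represented by the pair \<open>(R, p)\<close>.\<close>

type_synonym rigid = "(real^3^3) \<times> (real^3)"

definition SE3 :: "rigid set" where
  "SE3 = {T. rotation_matrix (fst T)}"

definition rigid_mult :: "rigid \<Rightarrow> rigid \<Rightarrow> rigid"  (infixl "\<odot>" 70) where
  "S \<odot> T = (fst S ** fst T, fst S *v snd T + snd S)"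

definition rigid_inv :: "rigid \<Rightarrow> rigid" where
  "rigid_inv T = (transpose (fst T), - (transpose (fst T) *v snd T))"

text \<open>Rodrigues' formula for the rotation by angle \<open>\<theta>\<close> about the oriented unit axis \<open>u\<close>.\<close>

definition axis_rotation :: "real^3 \<Rightarrow> real \<Rightarrow> real^3^3" where
  "axis_rotation u \<theta> =
     matrix (\<lambda>x. cos \<theta> *\<^sub>R x + sin \<theta> *\<^sub>R cross3 u x + ((1 - cos \<theta>) * (u \<bullet> x)) *\<^sub>R u)"

definition skew :: "real^3 \<Rightarrow> real^3^3" where
  "skew w = matrix (cross3 w)"

datatype leg = Left_Leg | Right_Leg

text \<open>
  A leg has joints \<open>0, \<dots>, 5\<close>, counted from the base to the foot. Joint \<open>j\<close> sits between the fixed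
  transforms \<open>link j\<close> and \<open>link (Suc j)\<close>; its rotation axis passes through the origin of the frame
  reached after \<open>link j\<close>, and \<open>joint_axis j\<close> is given in the coordinates of that frame.
  Entries with larger indices are irrelevant.
\<close>

record leg_model =
  link :: "nat \<Rightarrow> rigid"
  joint_axis :: "nat \<Rightarrow> real^3"

definition valid_leg :: "leg_model \<Rightarrow> bool" where
  "valid_leg M \<longleftrightarrow> (\<forall>j\<le>6. link M j \<in> SE3) \<and> (\<forall>j<6. norm (joint_axis M j) = 1)"

text \<open>
  \<open>chain M \<theta> j\<close> maps coordinates in the frame of joint \<open>j\<close> (before the rotation of joint \<open>j\<close> itself)
  to base coordinates; \<open>chain M \<theta> 6\<close> maps foot coordinates to base coordinates.
\<close>

primrec chain :: "leg_model \<Rightarrow> (nat \<Rightarrow> real) \<Rightarrow> nat \<Rightarrow> rigid" where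
  "chain M \<theta> 0 = link M 0"
| "chain M \<theta> (Suc j) = chain M \<theta> j \<odot> (axis_rotation (joint_axis M j) (\<theta> j), 0) \<odot> link M (Suc j)"

text \<open>
  Position of joint \<open>j < 6\<close> of a leg in the vector of all 12 joint angles: the left leg comes first.
\<close>

definition joint_idx :: "leg \<Rightarrow> nat \<Rightarrow> 12" where
  "joint_idx l j = of_nat (case l of Left_Leg \<Rightarrow> j | Right_Leg \<Rightarrow> 6 + j)"

type_synonym robot = "leg \<Rightarrow> leg_model"

definition leg_angles :: "leg \<Rightarrow> real^12 \<Rightarrow> nat \<Rightarrow> real" where
  "leg_angles l q j = q $ joint_idx l j"

definition foot_pose :: "robot \<Rightarrow> leg \<Rightarrow> real^12 \<Rightarrow> rigid" where
  "foot_pose rob l q = chain (rob l) (leg_angles l q) 6"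

definition inter_foot :: "robot \<Rightarrow> real^12 \<Rightarrow> rigid" where
  "inter_foot rob q = rigid_inv (foot_pose rob Left_Leg q) \<odot> foot_pose rob Right_Leg q"

text \<open>
  Below, \<open>qe\<close> is the encoder reading of one time sample, \<open>d\<close> the offset vector and \<open>Cref\<close> the
  reference inter-foot transform.
\<close>

definition residual_rotation :: "robot \<Rightarrow> rigid \<Rightarrow> real^12 \<Rightarrow> real^12 \<Rightarrow> real^3^3" where
  "residual_rotation rob Cref qe d = fst (rigid_inv Cref \<odot> inter_foot rob (qe + d))"

definition residual_rotation_partial ::
    "robot \<Rightarrow> rigid \<Rightarrow> real^12 \<Rightarrow> real^12 \<Rightarrow> 12 \<Rightarrow> real^3^3" where
  "residual_rotation_partial rob Cref qe d i =
     vector_derivative (\<lambda>t. residual_rotation rob Cref qe (d + t *\<^sub>R axis i 1)) (at 0)"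

definition angular_column :: "robot \<Rightarrow> rigid \<Rightarrow> real^12 \<Rightarrow> real^12 \<Rightarrow> 12 \<Rightarrow> real^3" where
  "angular_column rob Cref qe d i =
     (THE w. skew w =
        transpose (residual_rotation rob Cref qe d) ** residual_rotation_partial rob Cref qe d i)"

text \<open>
  \<open>Q\<close> is the rotation from right-foot coordinates to residual-frame coordinates, and \<open>seg\<close> lists the
  joints of leg \<open>l\<close> that form the segment.
\<close>

definition angular_jacobian ::
    "robot \<Rightarrow> rigid \<Rightarrow> real^12 \<Rightarrow> real^12 \<Rightarrow> real^3^3 \<Rightarrow> leg \<Rightarrow> ('n \<Rightarrow> nat) \<Rightarrow> real^'n^3" where
  "angular_jacobian rob Cref qe d Q l seg =
     transpose (\<chi> i. Q *v angular_column rob Cref qe d (joint_idx l (seg i)))"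

definition axis_in_residual_frame ::
    "robot \<Rightarrow> real^3^3 \<Rightarrow> real^12 \<Rightarrow> leg \<Rightarrow> nat \<Rightarrow> real^3" where
  "axis_in_residual_frame rob Q q l j =
     Q *v (transpose (fst (foot_pose rob Right_Leg q)) *v
           (fst (chain (rob l) (leg_angles l q) j) *v joint_axis (rob l) j))"

text \<open>
  The right foot pose enters the inter-foot transform directly and the left one inverted; with the
  convention \<open>R\<^sup>T \<partial>R\<close> this determines the sign with which a joint axis appears in the Jacobian.
\<close>

definition leg_sign :: "leg \<Rightarrow> real" where
  "leg_sign l = (case l of Left_Leg \<Rightarrow> -1 | Right_Leg \<Rightarrow> 1)"

end

theory Submission
  imports Defs
begin

text \<open>
  Since rotations conjugate axis rotations into axis rotations, shifting one joint angle by \<open>t\<close>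
  multiplies the orientation of every later frame of the leg from the left by the rotation by \<open>t\<close>
  about the joint axis in base coordinates. In the inter-foot rotation this factor sits directly
  to the left of the right foot orientation, inverted if the joint belongs to the left leg, so
  differentiating at \<open>t = 0\<close> yields the joint axis in right-foot coordinates up to the sign of the
  leg. Hence all columns of the Jacobian coincide, and its kernel is the hyperplane of
  perturbations with vanishing sum.
\<close>

section \<open>Skew matrices, axis rotations and their derivative\<close>

lemma skew_mult_vec: "skew w *v x = cross3 w x"
proof -
  have "linear (cross3 w)"
    using bilinear_cross by (simp add: bilinear_def)
  then show ?thesis
    by (simp add: skew_def matrix_works)
qed

text \<open>Makes the definite description in \<open>angular_column\<close> determine its value: a
  nonzero vector has a nonzero cross product with some basis vector.\<close>

lemma skew_inject: "skew v = skew w \<longleftrightarrow> v = w"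
proof
  assume "skew v = skew w"
  then have "cross3 v x = cross3 w x" for x
    by (metis skew_mult_vec)
  then have "cross3 (v - w) x = 0" for x
    by (simp add: Cross3.left_diff_distrib)
  then show "v = w"
    using cross_basis_nonzero[of "v - w"] by auto
qed simp

lemma axis_rotation_mult_vec:
  "axis_rotation u \<theta> *v x =
    cos \<theta> *\<^sub>R x + sin \<theta> *\<^sub>R cross3 u x + ((1 - cos \<theta>) * (u \<bullet> x)) *\<^sub>R u"
proof -
  have "linear (\<lambda>x. cos \<theta> *\<^sub>R x + sin \<theta> *\<^sub>R cross3 u x + ((1 - cos \<theta>) * (u \<bullet> x)) *\<^sub>R u)"
    by (rule linearI)
      (simp_all add: cross_add_right cross_mult_right inner_right_distrib scaleR_add_left algebra_simps)
  then show ?thesis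
    by (simp add: axis_rotation_def matrix_works)
qed

text \<open>For a unit axis, Lagrange's identity turns the double product u x (u x x) into (u . x) u
  - x; the addition formulas of sine and cosine do the rest.\<close>

lemma axis_rotation_add:
  assumes "norm u = 1"
  shows "axis_rotation u (s + t) = axis_rotation u s ** axis_rotation u t"
proof -
  have u: "u \<bullet> u = 1"
    using assms by (simp add: norm_eq_1)
  have "axis_rotation u (s + t) *v x = (axis_rotation u s ** axis_rotation u t) *v x" for x
    by (simp add: matrix_vector_mul_assoc[symmetric] axis_rotation_mult_vec cos_add sin_add
        cross_add_right cross_mult_right inner_right_distrib dot_cross_self Lagrange u)
      (simp add: algebra_simps)
  then show ?thesis
    by (simp add: matrix_eq)
qed

lemma axis_rotation_0: "axis_rotation u 0 = mat 1"
  by (simp add: matrix_eq axis_rotation_mult_vec)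

text \<open>Of the three terms in Rodrigues' formula only the cross product is antisymmetric, so
  transposing amounts to reversing the axis.\<close>

lemma transpose_axis_rotation: "transpose (axis_rotation u t) = axis_rotation (- u) t"
proof -
  have "(axis_rotation (- u) t *v x) \<bullet> y = x \<bullet> (axis_rotation u t *v y)" for x y
  proof -
    have "cross3 u x \<bullet> y = - (x \<bullet> cross3 u y)"
      by (simp add: cross3_simps)
    then show ?thesis
      by (simp add: axis_rotation_mult_vec inner_add_left inner_add_right inner_diff_right
          inner_commute algebra_simps)
  qed
  then have "(axis_rotation (- u) t *v x - transpose (axis_rotation u t) *v x) \<bullet> y = 0" for x y
    by (simp add: inner_diff_left dot_lmul_matrix[symmetric])
  then show ?thesis
    by (metis matrix_eq inner_eq_zero_iff eq_iff_diff_eq_0)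
qed

lemma axis_rotation_minus: "axis_rotation (- u) t = axis_rotation u (- t)"
  by (simp add: matrix_eq axis_rotation_mult_vec)

lemma rotation_matrix_axis_rotation:
  assumes "norm u = 1"
  shows "rotation_matrix (axis_rotation u t)"
proof -
  have inv: "axis_rotation u (- t) ** axis_rotation u t = mat 1"
    using axis_rotation_add[OF assms, of "- t" t] by (simp add: axis_rotation_0)
  have "orthogonal_matrix (axis_rotation u t)"
    using inv by (simp add: orthogonal_matrix transpose_axis_rotation axis_rotation_minus)
  \<comment> \<open>Halving the angle exhibits the determinant as a square, which excludes the value
    -1 left open by orthogonality.\<close>
  moreover have "det (axis_rotation u t) = (det (axis_rotation u (t / 2)))\<^sup>2"
    using axis_rotation_add[OF assms, of "t / 2" "t / 2"] by (simp add: det_mul power2_eq_square)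
  ultimately show ?thesis
    using det_orthogonal_matrix[of "axis_rotation u t"]
      zero_le_power2[of "det (axis_rotation u (t / 2))"]
    by (auto simp: rotation_matrix_def)
qed

lemma rotation_matrix_mult:
  fixes A B :: "real^'n^'n"
  shows "rotation_matrix A \<Longrightarrow> rotation_matrix B \<Longrightarrow> rotation_matrix (A ** B)"
  by (simp add: rotation_matrix_def orthogonal_matrix_mul det_mul)

lemma rotation_matrix_transpose: "rotation_matrix A \<Longrightarrow> rotation_matrix (transpose A)"
  by (simp add: rotation_matrix_def det_transpose orthogonal_matrix_def)

lemma inner_rotation:
  fixes P :: "real^'n^'n"
  assumes "rotation_matrix P"
  shows "(P *v x) \<bullet> (P *v y) = x \<bullet> y"
proof -
  have "(P *v x) \<bullet> (P *v y) = (transpose P *v (P *v x)) \<bullet> y"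
    by (simp add: dot_lmul_matrix)
  also have "transpose P *v (P *v x) = x"
    using assms
    by (simp add: rotation_matrix_def orthogonal_matrix_def matrix_vector_mul_assoc
        del: transpose_matrix_vector)
  finally show ?thesis .
qed

text \<open>Rodrigues' formula is built from inner and cross products, and a rotation preserves
  both.\<close>

lemma axis_rotation_conjugate:
  assumes "rotation_matrix P"
  shows "P ** axis_rotation u t = axis_rotation (P *v u) t ** P"
  using assms
  by (simp add: matrix_eq matrix_vector_mul_assoc[symmetric] axis_rotation_mult_vec inner_rotation
      cross_rotation_matrix matrix_vector_right_distrib matrix_vector_mult_scaleR)

lemma skew_conjugate:
  assumes "rotation_matrix P"
  shows "transpose P ** skew w ** P = skew (transpose P *v w)"
proof -
  have "transpose P *v (P *v x) = x" for x
    using assms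
    by (simp add: rotation_matrix_def orthogonal_matrix_def matrix_vector_mul_assoc
        del: transpose_matrix_vector)
  then have "transpose P *v cross3 w (P *v x) = cross3 (transpose P *v w) x" for x
    using cross_rotation_matrix[OF rotation_matrix_transpose[OF assms], of w "P *v x"] by metis
  then show ?thesis
    by (simp add: matrix_eq matrix_vector_mul_assoc[symmetric] skew_mult_vec
        del: transpose_matrix_vector)
qed

lemma axis_rotation_has_vector_derivative:
  "((\<lambda>t. X ** axis_rotation u t ** Y) has_vector_derivative X ** skew u ** Y) (at 0)"
proof -
  \<comment> \<open>The rank-one matrix u u^T, so that Rodrigues' formula becomes a combination of
    three constant matrices with scalar coefficients; at 0 only the sine coefficient has a nonzero
    derivative.\<close>
  define Z where "Z = matrix (\<lambda>x. (u \<bullet> x) *\<^sub>R u)"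
  have Z: "Z *v x = (u \<bullet> x) *\<^sub>R u" for x
  proof -
    have "linear (\<lambda>x. (u \<bullet> x) *\<^sub>R u)"
      by (rule linearI) (simp_all add: inner_right_distrib scaleR_add_left)
    then show ?thesis
      by (simp add: Z_def matrix_works)
  qed
  have eq: "X ** axis_rotation u t ** Y =
      cos t *\<^sub>R (X ** Y) + sin t *\<^sub>R (X ** skew u ** Y) + (1 - cos t) *\<^sub>R (X ** Z ** Y)" for t
    by (simp add: matrix_eq matrix_vector_mul_assoc[symmetric] axis_rotation_mult_vec Z
        skew_mult_vec matrix_vector_mult_add_rdistrib matrix_vector_right_distrib
        matrix_vector_mult_scaleR scaleR_matrix_vector_assoc[symmetric])
  show ?thesis
    unfolding eq
    by (auto intro!: derivative_eq_intros)
qed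

section \<open>Orientations along a leg under a shift of one joint angle\<close>

lemma fst_rigid_mult [simp]: "fst (S \<odot> T) = fst S ** fst T"
  by (simp add: rigid_mult_def)

lemma fst_rigid_inv [simp]: "fst (rigid_inv T) = transpose (fst T)"
  by (simp add: rigid_inv_def)

lemma rotation_matrix_chain:
  assumes "valid_leg M" "m \<le> 6"
  shows "rotation_matrix (fst (chain M \<theta> m))"
  using assms(2)
proof (induction m)
  case 0
  then show ?case
    using assms(1) by (simp add: valid_leg_def SE3_def)
next
  case (Suc m)
  then show ?case
    using assms(1)
    by (simp add: valid_leg_def SE3_def rotation_matrix_mult rotation_matrix_axis_rotation)
qed

lemma chain_cong:
  "(\<And>i. i < m \<Longrightarrow> \<theta> i = \<theta>' i) \<Longrightarrow> chain M \<theta> m = chain M \<theta>' m"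
  by (induction m) auto

text \<open>Induction along the leg. At joint \<open>j\<close> the extra rotation splits off and
  conjugation carries it to the far left; every later factor multiplies on the right and leaves it
  in place.\<close>

lemma chain_shift:
  assumes M: "valid_leg M" and "j < m" "m \<le> 6"
    and "\<And>i. i < m \<Longrightarrow> \<theta>' i = \<theta> i + (if i = j then t else 0)"
  shows "fst (chain M \<theta>' m) =
    axis_rotation (fst (chain M \<theta> j) *v joint_axis M j) t ** fst (chain M \<theta> m)"
  using assms(2-)
proof (induction m)
  case 0
  then show ?case by simp
next
  case (Suc m)
  show ?case
  proof (cases "m = j")
    case True
    \<comment> \<open>The frame before joint \<open>j\<close> depends only on the angles of earlier
      joints.\<close>
    have "chain M \<theta>' j = chain M \<theta> j"
      using Suc.prems True by (intro chain_cong) auto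
    moreover have "fst (chain M \<theta> j) ** axis_rotation (joint_axis M j) t =
        axis_rotation (fst (chain M \<theta> j) *v joint_axis M j) t ** fst (chain M \<theta> j)"
      using M Suc.prems by (intro axis_rotation_conjugate rotation_matrix_chain) auto
    moreover have "axis_rotation (joint_axis M j) (t + \<theta> j) =
        axis_rotation (joint_axis M j) t ** axis_rotation (joint_axis M j) (\<theta> j)"
      using M Suc.prems by (intro axis_rotation_add) (auto simp: valid_leg_def)
    ultimately show ?thesis
      using True Suc.prems(3)[of j]
      by (simp add: add.commute matrix_mul_assoc)
  next
    case False
    then show ?thesis
      using Suc by (simp add: matrix_mul_assoc)
  qed
qed

text \<open>The index type computes modulo 12; the two legs occupy 0 to 5 and 6 to 11, so nothing
  wraps around.\<close>

lemma joint_idx_inject: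
  assumes "i < 6" "j < 6"
  shows "joint_idx l i = joint_idx l' j \<longleftrightarrow> l = l' \<and> i = j"
proof -
  have "i \<in> {0, 1, 2, 3, 4, 5}" "j \<in> {0, 1, 2, 3, 4, 5}"
    using assms by auto
  then show ?thesis
    unfolding joint_idx_def by (cases l; cases l') auto
qed

lemma foot_pose_shift:
  assumes "valid_leg (rob l')" "j < 6"
  shows "fst (foot_pose rob l' (q + t *\<^sub>R axis (joint_idx l j) 1)) =
    (if l' = l
     then axis_rotation (fst (chain (rob l) (leg_angles l q) j) *v joint_axis (rob l) j) t
     else mat 1) ** fst (foot_pose rob l' q)"
proof -
  have angle: "leg_angles l' (q + t *\<^sub>R axis (joint_idx l j) 1) i =
      leg_angles l' q i + (if l' = l \<and> i = j then t else 0)" if "i < 6" for i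
    using joint_idx_inject[OF that assms(2)] by (auto simp: leg_angles_def axis_def)
  show ?thesis
  proof (cases "l' = l")
    case True
    then show ?thesis
      unfolding foot_pose_def
      using assms angle by (subst chain_shift[where \<theta> = "leg_angles l q" and t = t and j = j]) auto
  next
    case False
    then have "chain (rob l') (leg_angles l' (q + t *\<^sub>R axis (joint_idx l j) 1)) 6 =
        chain (rob l') (leg_angles l' q) 6"
      using angle by (intro chain_cong) auto
    with False show ?thesis
      by (simp add: foot_pose_def)
  qed
qed

section \<open>The residual rotation and its Jacobian\<close>

lemma residual_rotation_shift:
  assumes "\<And>l'. valid_leg (rob l')" "j < 6"
  shows "residual_rotation rob Cref qe (d + t *\<^sub>R axis (joint_idx l j) 1) =
    transpose (fst Cref) ** transpose (fst (foot_pose rob Left_Leg (qe + d)))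
    ** axis_rotation (leg_sign l *\<^sub>R
         (fst (chain (rob l) (leg_angles l (qe + d)) j) *v joint_axis (rob l) j)) t
    ** fst (foot_pose rob Right_Leg (qe + d))"
  using assms
  \<comment> \<open>For the left leg the transpose reverses the axis, which is the sign -1 of
    \<open>leg_sign\<close>; for the right leg the rotation enters unchanged.\<close>
  by (cases l)
    (simp_all add: residual_rotation_def inter_foot_def foot_pose_shift add.assoc[symmetric]
      leg_sign_def matrix_mul_assoc matrix_transpose_mul transpose_axis_rotation)

text \<open>With the residual rotation varying as X A(t) S, the orthogonal factor X cancels from R^T
  dR, and conjugation by S moves the skew matrix of the axis into right-foot coordinates.\<close>

lemma angular_column_eq:
  assumes rob: "\<And>l'. valid_leg (rob l')" and Cref: "Cref \<in> SE3" and "j < 6"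
  shows "angular_column rob Cref qe d (joint_idx l j) =
    leg_sign l *\<^sub>R (transpose (fst (foot_pose rob Right_Leg (qe + d))) *v
      (fst (chain (rob l) (leg_angles l (qe + d)) j) *v joint_axis (rob l) j))"
proof -
  define g where "g = fst (chain (rob l) (leg_angles l (qe + d)) j) *v joint_axis (rob l) j"
  define S where "S = fst (foot_pose rob Right_Leg (qe + d))"
  define X where "X = transpose (fst Cref) ** transpose (fst (foot_pose rob Left_Leg (qe + d)))"
  have S: "rotation_matrix S"
    using rob by (simp add: S_def foot_pose_def rotation_matrix_chain)
  have "rotation_matrix X"
    using rob Cref
    by (simp add: X_def foot_pose_def rotation_matrix_chain rotation_matrix_mult
        rotation_matrix_transpose SE3_def)
  then have X: "transpose X ** X = mat 1"
    by (simp add: rotation_matrix_def orthogonal_matrix_def)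
  have shift: "residual_rotation rob Cref qe (d + t *\<^sub>R axis (joint_idx l j) 1) =
      X ** axis_rotation (leg_sign l *\<^sub>R g) t ** S" for t
    using residual_rotation_shift[OF rob \<open>j < 6\<close>] by (simp add: X_def S_def g_def)
  have base: "residual_rotation rob Cref qe d = X ** S"
    using shift[of 0] by (simp add: axis_rotation_0)
  have "residual_rotation_partial rob Cref qe d (joint_idx l j) =
      X ** skew (leg_sign l *\<^sub>R g) ** S"
    unfolding residual_rotation_partial_def shift
    by (rule vector_derivative_at[OF axis_rotation_has_vector_derivative])
  then have "transpose (residual_rotation rob Cref qe d) **
      residual_rotation_partial rob Cref qe d (joint_idx l j) =
      transpose S ** (transpose X ** X) ** skew (leg_sign l *\<^sub>R g) ** S"
    by (simp add: base matrix_transpose_mul matrix_mul_assoc)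
  also have "\<dots> = skew (transpose S *v (leg_sign l *\<^sub>R g))"
    using S by (simp add: X skew_conjugate)
  finally have "angular_column rob Cref qe d (joint_idx l j) = transpose S *v (leg_sign l *\<^sub>R g)"
    by (simp add: angular_column_def skew_inject)
  then show ?thesis
    by (simp add: matrix_vector_mult_scaleR S_def g_def)
qed

theorem proposition1:
  fixes rob :: robot
    and Cref :: rigid
    and q_enc :: "nat \<Rightarrow> real^12" and k :: nat
    and d :: "real^12"
    and Q :: "real^3^3"
    and l :: leg
    and s :: nat and seg :: "'n::finite \<Rightarrow> nat"
    and a :: "real^3"
  defines "J \<equiv> angular_jacobian rob Cref (q_enc k) d Q l seg"
  assumes "\<And>l'. valid_leg (rob l')"
    and "Cref \<in> SE3"
    and "rotation_matrix Q"
    and "CARD('n) \<ge> 2"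
    and "bij_betw seg UNIV {s..<s + CARD('n)}"
    and "s + CARD('n) \<le> 6"
    and "norm a = 1"
    and "\<And>i. axis_in_residual_frame rob Q (q_enc k + d) l (seg i) = a"
  shows "collinear (insert 0 (columns J))
    \<and> (\<exists>\<sigma>\<in>{1, -1}. \<sigma> = leg_sign l \<and>
          (\<forall>\<delta> :: real^'n. J *v \<delta> = (\<sigma> * (\<Sum>i\<in>UNIV. \<delta> $ i)) *\<^sub>R a))
    \<and> dim {\<delta> :: real^'n. J *v \<delta> = 0} = CARD('n) - 1"
proof -
  have "seg i < s + CARD('n)" for i
    using bij_betwE[OF assms(6)] by auto
  then have "seg i < 6" for i
    using assms(7) by (rule less_le_trans)
  then have "Q *v angular_column rob Cref (q_enc k) d (joint_idx l (seg i)) = leg_sign l *\<^sub>R a" for i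
    using assms(9)[of i]
    by (simp add: angular_column_eq assms(2,3) axis_in_residual_frame_def
        matrix_vector_mult_scaleR del: transpose_matrix_vector)
  then have column: "column i J = leg_sign l *\<^sub>R a" for i
    by (simp add: J_def angular_jacobian_def column_def transpose_def vec_eq_iff)
  have mult: "J *v \<delta> = (leg_sign l * (\<Sum>i\<in>UNIV. \<delta> $ i)) *\<^sub>R a" for \<delta>
    by (simp add: matrix_mult_sum column scalar_mult_eq_scaleR scaleR_sum_left[symmetric]
        sum_distrib_left mult.commute)
  have sign: "leg_sign l \<in> {1, -1}"
    by (cases l) (simp_all add: leg_sign_def)
  \<comment> \<open>All columns are one vector, so together with 0 there are at most two points;
    including 0 puts the line through the origin.\<close>
  have "columns J \<subseteq> {leg_sign l *\<^sub>R a}"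
    by (auto simp: columns_def column)
  then have "collinear (insert 0 (columns J))"
    using collinear_subset[OF collinear_2[of 0 "leg_sign l *\<^sub>R a"]] by blast
  \<comment> \<open>Here \<open>1\<close> is the all-ones vector, whose inner product with \<delta>
    is the sum of the offsets. As the sign and \<open>a\<close> are nonzero, the kernel is its
    orthogonal hyperplane.\<close>
  moreover have "{\<delta>. J *v \<delta> = 0} = {\<delta>. (1 :: real^'n) \<bullet> \<delta> = 0}"
    using sign assms(8) by (auto simp: mult inner_vec_def)
  then have "dim {\<delta>. J *v \<delta> = 0} = CARD('n) - 1"
    by (simp add: dim_hyperplane)
  ultimately show ?thesis
    using mult sign by blast
qed

end
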